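(* For every integer $n \ge 9$, $\mathrm{eqdim}(J_{n,3}) \le n-2$.
   Context: For positive integers $n > k$, the Johnson graph $J_{n,k}$ has as vertices all $k$-element subsets of $\{1,\dots,n\}$, two such subsets $A,B$ being adjacent iff $|A \cap B| = k-1$. In a connected graph $G$, $d(u,v)$ is the shortest-path distance. A subset $S \subseteq V(G)$ is a distance-equalizer set of $G$ if for every two distinct vertices $u,v \in V(G)\setminus S$ there exists $x \in S$ with $d(u,x) = d(v,x)$. The equidistant dimension $\mathrm{eqdim}(G)$ is the minimum cardinality of a distance-equalizer set of $G$. *)

theory Defs
  imports "Graph_Theory.Graph_Theory"
begin

definition johnson_graph :: "nat \<Rightarrow> nat \<Rightarrow> nat set pair_pre_digraph" where
  "johnson_graph n k =
     \<lparr> pverts = {A. A \<subseteq> {1..n} \<and> card A = k},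
       parcs = {(A, B). A \<subseteq> {1..n} \<and> card A = k \<and> B \<subseteq> {1..n} \<and> card B = k \<and>
                        card (A \<inter> B) = k - 1} \<rparr>"

text \<open>Every arc has weight 1, so the cost of a walk is its number of arcs.\<close>

definition graph_dist :: "('a, 'b) pre_digraph \<Rightarrow> 'a \<Rightarrow> 'a \<Rightarrow> ereal" where
  "graph_dist G u v = wf_digraph.\<mu> G (\<lambda>_. 1) u v"

definition distance_equalizer_set :: "('a, 'b) pre_digraph \<Rightarrow> 'a set \<Rightarrow> bool" where
  "distance_equalizer_set G S \<longleftrightarrow>
     S \<subseteq> verts G \<and>
     (\<forall>u \<in> verts G - S. \<forall>v \<in> verts G - S. u \<noteq> v \<longrightarrow>
        (\<exists>x \<in> S. graph_dist G u x = graph_dist G v x))"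

text \<open>The finiteness condition only guards against \<^const>\<open>card\<close> being 0 on infinite sets.\<close>

definition eqdim :: "('a, 'b) pre_digraph \<Rightarrow> nat" where
  "eqdim G = (LEAST m. \<exists>S. distance_equalizer_set G S \<and> finite S \<and> card S = m)"

lemma pair_graph_johnson_graph:
  assumes "0 < k"
  shows "pair_graph (johnson_graph n k)"
proof
  let ?V = "{A. A \<subseteq> {1..n} \<and> card A = k}"
  have fin: "finite ?V"
    by (rule finite_subset[of _ "Pow {1..n}"]) auto
  then show "finite (pverts (johnson_graph n k))"
    by (simp add: johnson_graph_def)
  have "parcs (johnson_graph n k) \<subseteq> ?V \<times> ?V"
    by (auto simp: johnson_graph_def)
  then show "finite (parcs (johnson_graph n k))"
    by (rule finite_subset) (intro finite_cartesian_product fin)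
  show "symmetric (with_proj (johnson_graph n k))"
    by (simp add: symmetric_def sym_def johnson_graph_def Int_commute)
next
  fix e assume e: "e \<in> parcs (johnson_graph n k)"
  then show "fst e \<in> pverts (johnson_graph n k)" "snd e \<in> pverts (johnson_graph n k)"
    by (auto simp: johnson_graph_def)
  show "fst e \<noteq> snd e"
  proof
    assume "fst e = snd e"
    with e have "k = k - 1"
      by (simp add: johnson_graph_def split: prod.splits)
    with assms show False by linarith
  qed
qed

lemma (in fin_digraph) eqdim_attained:
  obtains S where "distance_equalizer_set G S" "finite S" "card S = eqdim G"
proof -
  have "distance_equalizer_set G (verts G)"
    by (simp add: distance_equalizer_set_def)
  then have "\<exists>m S. distance_equalizer_set G S \<and> finite S \<and> card S = m"
    using finite_verts by blast
  from LeastI_ex[OF this] show ?thesis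
    using that unfolding eqdim_def by blast
qed

end

theory Submission
  imports Defs
begin

text \<open>
  The distance of two vertices of a Johnson graph is determined by the size of their intersection.
  The \<open>n - 2\<close> triples \<open>{1, 2, i}\<close> with \<open>3 \<le> i \<le> n\<close> form a distance-equalizer set: every other
  triple \<open>u\<close> has at most one element in \<open>{1, 2}\<close>, so it meets \<open>{1, 2, i}\<close> in
  \<open>|u \<inter> {1, 2}| + [i \<in> u]\<close> points with first summand 0 or 1. If the first summands of \<open>u\<close> and \<open>v\<close>
  agree, any \<open>i\<close> outside \<open>u \<union> v\<close> equalizes them, and \<open>n - 2 > 6\<close> provides one. If they are 0 for
  \<open>u\<close> and 1 for \<open>v\<close>, then \<open>u\<close> has three elements above 2 and \<open>v\<close> only two, and any
  \<open>i \<in> u - v\<close> above 2 equalizes them.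
\<close>

lemma pverts_johnson_graph [simp]:
  "A \<in> pverts (johnson_graph n k) \<longleftrightarrow> A \<subseteq> {1..n} \<and> card A = k"
  by (simp add: johnson_graph_def)

lemma parcs_johnson_graph [simp]:
  "(A, B) \<in> parcs (johnson_graph n k) \<longleftrightarrow>
     A \<subseteq> {1..n} \<and> card A = k \<and> B \<subseteq> {1..n} \<and> card B = k \<and> card (A \<inter> B) = k - 1"
  by (simp add: johnson_graph_def)

lemma wf_digraph_johnson_graph:
  assumes "0 < k"
  shows "wf_digraph (with_proj (johnson_graph n k))"
proof -
  interpret pair_graph "johnson_graph n k"
    using assms by (rule pair_graph_johnson_graph)
  show ?thesis by (rule wf_digraph)
qed

lemma (in wf_digraph) awalk_cost_one: "awalk_cost (\<lambda>_. 1) p = real (length p)"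
  by (induction p) simp_all

text \<open>An arc exchanges a single element, so each step of a walk raises the size of the
  intersection with \<open>B\<close> by at most 1, and this size must reach \<open>k\<close> at the
  end.\<close>

lemma johnson_graph_awalk_length_ge:
  assumes "0 < k" and "pre_digraph.awalk (with_proj (johnson_graph n k)) A p B"
  shows "k \<le> card (A \<inter> B) + length p"
proof -
  interpret wf_digraph "with_proj (johnson_graph n k)"
    using assms(1) by (rule wf_digraph_johnson_graph)
  show ?thesis
    using assms(2)
  proof (induction p arbitrary: A)
    case Nil
    then show ?case by (auto simp: awalk_Nil_iff)
  next
    case (Cons e p)
    obtain C where e: "e = (A, C)" and walk: "awalk C p B"
      using Cons.prems by (cases e) (auto simp: awalk_Cons_iff)
    have "(A, C) \<in> parcs (johnson_graph n k)"
      using Cons.prems e by (simp add: awalk_Cons_iff)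
    then have C: "card C = k" "card (C \<inter> A) = k - 1" and fin: "finite A" "finite C"
      by (auto simp: Int_commute intro: finite_subset)
    \<comment> \<open>\<open>0 < k\<close> enters here: \<open>k - (k - 1) = 1\<close> fails for
      \<open>k = 0\<close> under truncated subtraction.\<close>
    have "card (C - A) = 1"
      using C fin assms(1) by (simp add: card_Diff_subset_Int)
    \<comment> \<open>Whatever \<open>C\<close> shares with \<open>B\<close> was already in
      \<open>A\<close> or is the one new element.\<close>
    have "card (C \<inter> B) \<le> card ((A \<inter> B) \<union> (C - A))"
      using fin by (intro card_mono) auto
    also have "\<dots> \<le> card (A \<inter> B) + card (C - A)"
      by (rule card_Un_le)
    finally show ?case
      using Cons.IH[OF walk] \<open>card (C - A) = 1\<close> by simp
  qed
qed

text \<open>Greedy exchange: trading an element of \<open>A - B\<close> for one of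
  \<open>B - A\<close> is an arc and brings the set one step closer to \<open>B\<close>.\<close>

lemma johnson_graph_awalk_exists:
  assumes "0 < k" and "A \<subseteq> {1..n}" "card A = k" "B \<subseteq> {1..n}" "card B = k"
  shows "\<exists>p. pre_digraph.awalk (with_proj (johnson_graph n k)) A p B \<and>
             length p = k - card (A \<inter> B)"
proof -
  interpret wf_digraph "with_proj (johnson_graph n k)"
    using assms(1) by (rule wf_digraph_johnson_graph)
  have finB: "finite B"
    using assms(4) by (rule finite_subset) simp
  show ?thesis
    using assms(2,3)
  proof (induction "k - card (A \<inter> B)" arbitrary: A)
    case 0
    have finA: "finite A"
      using 0(2) by (rule finite_subset) simp
    have "k \<le> card (A \<inter> B)" using 0(1) by simp
    then have "A \<inter> B = A" "A \<inter> B = B"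
      using 0(3) finA finB assms(5) by (simp_all add: card_seteq)
    then have "A = B" by blast
    then show ?case
      using assms by (intro exI[of _ "[]"]) (simp add: awalk_Nil_iff)
  next
    case (Suc m)
    have finA: "finite A"
      using Suc.prems(1) by (rule finite_subset) simp
    have lt: "card (A \<inter> B) < k" using Suc.hyps(2) by simp
    have "card (A - B) > 0" "card (B - A) > 0"
      using lt finA finB Suc.prems(2) assms(5)
      by (simp_all add: card_Diff_subset_Int Int_commute)
    then obtain a b where a: "a \<in> A" "a \<notin> B" and b: "b \<in> B" "b \<notin> A"
      by (metis DiffE card_gt_0_iff ex_in_conv)
    define C where "C = insert b (A - {a})"
    have C: "C \<subseteq> {1..n}" "card C = k"
      using Suc.prems assms(1,4) a b finA by (auto simp: C_def)
    have "A \<inter> C = A - {a}"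
      using b by (auto simp: C_def)
    then have arc: "(A, C) \<in> parcs (johnson_graph n k)"
      using C Suc.prems a finA by simp
    have "C \<inter> B = insert b (A \<inter> B)"
      using a b by (auto simp: C_def)
    then have card: "card (C \<inter> B) = Suc (card (A \<inter> B))"
      using b finA by simp
    then have "m = k - card (C \<inter> B)"
      using Suc.hyps(2) by simp
    then obtain p where "awalk C p B" "length p = k - card (C \<inter> B)"
      using Suc.hyps(1) C by blast
    \<comment> \<open>By \<open>lt\<close> the truncated subtraction drops by exactly 1 along the
      new arc.\<close>
    then show ?case
      using arc card lt by (intro exI[of _ "(A, C) # p"]) (simp add: awalk_Cons_iff)
  qed
qed

text \<open>The greedy walk attains the lower bound on the length of all walks. Equal distances thus
  reduce to equal intersection sizes.\<close>

theorem graph_dist_johnson_graph: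
  assumes "0 < k" and "A \<subseteq> {1..n}" "card A = k" "B \<subseteq> {1..n}" "card B = k"
  shows "graph_dist (with_proj (johnson_graph n k)) A B = ereal (real (k - card (A \<inter> B)))"
proof -
  interpret wf_digraph "with_proj (johnson_graph n k)"
    using assms(1) by (rule wf_digraph_johnson_graph)
  obtain p where p: "awalk A p B" "length p = k - card (A \<inter> B)"
    using johnson_graph_awalk_exists[OF assms] by blast
  show ?thesis
    unfolding graph_dist_def
  proof (rule antisym)
    show "\<mu> (\<lambda>_. 1) A B \<le> ereal (real (k - card (A \<inter> B)))"
      using min_cost_le_walk_cost[OF p(1), of "\<lambda>_. 1"] p(2) by (simp add: awalk_cost_one)
    show "ereal (real (k - card (A \<inter> B))) \<le> \<mu> (\<lambda>_. 1) A B"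
      unfolding \<mu>_def
    proof (rule INF_greatest)
      fix q assume "q \<in> {p. awalk A p B}"
      then have "k - card (A \<inter> B) \<le> length q"
        using johnson_graph_awalk_length_ge[OF assms(1), of n A q B] by simp
      then show "ereal (real (k - card (A \<inter> B))) \<le> ereal (awalk_cost (\<lambda>_. 1) q)"
        by (simp add: awalk_cost_one)
    qed
  qed
qed

lemma (in fin_digraph) eqdim_le_card:
  assumes "distance_equalizer_set G S"
  shows "eqdim G \<le> card S"
proof -
  have "finite S"
    using assms finite_verts by (auto simp: distance_equalizer_set_def intro: finite_subset)
  with assms show ?thesis
    unfolding eqdim_def by (intro Least_le) blast
qed

definition pencil :: "nat \<Rightarrow> nat set set" where
  "pencil n = (\<lambda>i. {1, 2, i}) ` {3..n}"

lemma card_pencil: "card (pencil n) = n - 2"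
proof -
  have "inj_on (\<lambda>i::nat. {1, 2, i}) {3..n}"
    by (rule inj_onI) (auto simp: insert_eq_iff doubleton_eq_iff)
  then show ?thesis
    by (simp add: pencil_def card_image)
qed

lemma card_Int_pencil:
  fixes u :: "nat set"
  assumes "finite u" "3 \<le> i"
  shows "card (u \<inter> {1, 2, i}) = card (u \<inter> {1, 2}) + (if i \<in> u then 1 else 0)"
proof (cases "i \<in> u")
  case True
  then have "u \<inter> {1, 2, i} = insert i (u \<inter> {1, 2})" by auto
  with True assms show ?thesis by simp
next
  case False
  then have "u \<inter> {1, 2, i} = u \<inter> {1, 2}" by auto
  with False show ?thesis by simp
qed

text \<open>A triple containing both 1 and 2 has exactly one further element, which lies in
  \<open>{3..n}\<close>, so it belongs to the pencil.\<close>

lemma not_in_pencil_split: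
  assumes "u \<subseteq> {1..n}" "card u = 3" "u \<notin> pencil n"
  shows "card (u \<inter> {1, 2}) \<le> 1" and "card (u \<inter> {3..n}) = 3 - card (u \<inter> {1, 2})"
proof -
  have fin: "finite u" using assms(1) by (rule finite_subset) simp
  have "u = (u \<inter> {1, 2}) \<union> (u \<inter> {3..n})" using assms(1) by force
  moreover have "card ((u \<inter> {1, 2}) \<union> (u \<inter> {3..n})) = card (u \<inter> {1, 2}) + card (u \<inter> {3..n})"
    using fin by (intro card_Un_disjoint) auto
  ultimately have sum: "card (u \<inter> {1, 2}) + card (u \<inter> {3..n}) = 3"
    using assms(2) by simp
  then show "card (u \<inter> {3..n}) = 3 - card (u \<inter> {1, 2})" by simp
  show "card (u \<inter> {1, 2}) \<le> 1"
  proof (rule ccontr)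
    assume big: "\<not> card (u \<inter> {1, 2}) \<le> 1"
    have "u \<inter> {1, 2} = {1, 2}"
      using big by (intro card_seteq) auto
    then have sub: "{1, 2} \<subseteq> u" by blast
    with \<open>u \<inter> {1, 2} = {1, 2}\<close> sum have "card (u \<inter> {3..n}) = 1" by simp
    then obtain i where "u \<inter> {3..n} = {i}" by (rule card_1_singletonE)
    then have "u = {1, 2, i}" "i \<in> {3..n}"
      using sub \<open>u = (u \<inter> {1, 2}) \<union> (u \<inter> {3..n})\<close> by auto
    then show False using assms(3) by (auto simp: pencil_def)
  qed
qed

lemma pencil_equalizes_less:
  assumes "u \<subseteq> {1..n}" "card u = 3" "u \<notin> pencil n"
    and "v \<subseteq> {1..n}" "card v = 3" "v \<notin> pencil n"
    and less: "card (u \<inter> {1, 2}) < card (v \<inter> {1, 2})"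
  shows "\<exists>x \<in> pencil n. card (u \<inter> x) = card (v \<inter> x)"
proof -
  have fin: "finite u" "finite v"
    using assms(1,4) by (auto intro: finite_subset)
  note u = not_in_pencil_split[OF assms(1-3)] and v = not_in_pencil_split[OF assms(4-6)]
  \<comment> \<open>The strict inequality between values at most 1 forces 0 and 1, so the two sides
    have sizes 3 and 2.\<close>
  have "\<not> u \<inter> {3..n} \<subseteq> v \<inter> {3..n}"
    using u v less fin card_mono[of "v \<inter> {3..n}" "u \<inter> {3..n}"] by auto
  then obtain i where "i \<in> {3..n}" "i \<in> u" "i \<notin> v" by blast
  \<comment> \<open>The point \<open>i\<close> lifts the count for \<open>u\<close> from 0 to 1,
    while the count for \<open>v\<close> stays at 1.\<close>
  moreover from this have "card (u \<inter> {1, 2, i}) = card (v \<inter> {1, 2, i})"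
    using u(1) v(1) less fin card_Int_pencil[of _ i] by simp
  ultimately show ?thesis
    unfolding pencil_def by blast
qed

lemma pencil_equalizes:
  assumes "n \<ge> 9"
    and "u \<subseteq> {1..n}" "card u = 3" "u \<notin> pencil n"
    and "v \<subseteq> {1..n}" "card v = 3" "v \<notin> pencil n"
  shows "\<exists>x \<in> pencil n. card (u \<inter> x) = card (v \<inter> x)"
proof (cases "card (u \<inter> {1, 2})" "card (v \<inter> {1, 2})" rule: linorder_cases)
  case less
  then show ?thesis using pencil_equalizes_less assms by blast
next
  case greater
  then show ?thesis using pencil_equalizes_less[of v n u] assms by force
next
  case equal
  have fin: "finite u" "finite v"
    using assms(2,5) by (auto intro: finite_subset)
  have "card (u \<union> v) \<le> 6"
    using card_Un_le[of u v] assms(3,6) by simp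
  \<comment> \<open>This is where \<open>n \<ge> 9\<close> is used:
    \<open>n - 2 \<ge> 7\<close>.\<close>
  moreover have "card {3..n} > 6" using assms(1) by simp
  ultimately have "\<not> {3..n} \<subseteq> u \<union> v"
    using card_mono[of "u \<union> v" "{3..n}"] fin by fastforce
  then obtain i where "i \<in> {3..n}" "i \<notin> u" "i \<notin> v" by blast
  moreover from this have "card (u \<inter> {1, 2, i}) = card (v \<inter> {1, 2, i})"
    using equal fin card_Int_pencil[of _ i] by simp
  ultimately show ?thesis
    unfolding pencil_def by blast
qed

lemma distance_equalizer_set_pencil:
  assumes "n \<ge> 9"
  shows "distance_equalizer_set (with_proj (johnson_graph n 3)) (pencil n)"
proof -
  have vert: "x \<subseteq> {1..n} \<and> card x = 3" if "x \<in> pencil n" for x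
    using that by (auto simp: pencil_def)
  have "\<exists>x \<in> pencil n. graph_dist (with_proj (johnson_graph n 3)) u x =
                      graph_dist (with_proj (johnson_graph n 3)) v x"
    if u: "u \<subseteq> {1..n}" "card u = 3" "u \<notin> pencil n"
      and v: "v \<subseteq> {1..n}" "card v = 3" "v \<notin> pencil n" for u v
  proof -
    obtain x where x: "x \<in> pencil n" and eq: "card (u \<inter> x) = card (v \<inter> x)"
      using pencil_equalizes[OF assms u v] by blast
    \<comment> \<open>All sets involved are triples in \<open>{1..n}\<close>, so the distance
      formula turns \<open>eq\<close> into equal distances.\<close>
    show ?thesis
      using x vert[OF x] u v eq by (intro bexI[of _ x]) (simp_all add: graph_dist_johnson_graph)
  qed
  then show ?thesis
    using vert by (auto simp: distance_equalizer_set_def)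
qed

theorem theorem4:
  fixes n :: nat
  assumes "n \<ge> 9"
  shows "eqdim (with_proj (johnson_graph n 3)) \<le> n - 2"
proof -
  interpret pair_graph "johnson_graph n 3"
    by (rule pair_graph_johnson_graph) simp
  show ?thesis
    using eqdim_le_card[OF distance_equalizer_set_pencil[OF assms]] by (simp add: card_pencil)
qed

end
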